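(* Let $\{X_\alpha\mid\alpha\in\Lambda\}$ be the set of $\kappa$-components of a digital image $(X,\kappa)$. Then $dH_n(X)\cong\bigoplus_{\alpha}dH_n(X_\alpha)$ for every $n$.
   Context: A digital image $(X,\kappa)$ is a finite subset $X\subset\mathbb{Z}^d$ ($d\ge 1$) equipped with an adjacency relation $\kappa=c_l$ for some $1\le l\le d$, where distinct points $p,q\in\mathbb{Z}^d$ are $c_l$-adjacent if at most $l$ of their coordinates differ by one unit and all remaining coordinates are equal. Subsets of $X$ are digital images with the same adjacency. A function $f:(X,\kappa)\to(Y,\lambda)$ is $(\kappa,\lambda)$-continuous if whenever $x_0,x_1$ are $\kappa$-adjacent, $f(x_0),f(x_1)$ are equal or $\lambda$-adjacent. A $\kappa$-path from $x$ to $y$ is a function $f:\{0,1,\dots,m\}\to X$ with $f(0)=x$, $f(m)=y$ and $f(t),f(t+1)$ equal or $\kappa$-adjacent for all $t<m$. A subset is $\kappa$-connected if any two distinct points of it are joined by a $\kappa$-path in it; a $\kappa$-component is a maximal $\kappa$-connected subset. Cubical singular homology. $I=\{0,1\}\subset\mathbb{Z}$, and $I^n$ carries the $c_1$-adjacency of $\mathbb{Z}^n$ (denoted $2n$); $I^0$ is a point. A digital $n$-cube in $(X,\kappa)$ is a $(2n,\kappa)$-continuous map $T:I^n\to X$; it is degenerate if for some $i$, $T(t_1,\dots,t_n)$ does not depend on $t_i$. $dQ_n(X)$ is the free abelian group on digital $n$-cubes, $dD_n(X)$ the subgroup generated by degenerate ones, $dC_n(X)=dQ_n(X)/dD_n(X)$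 (zero for $n<0$). Put $A_iT(t_1,\dots,t_{n-1})=T(t_1,\dots,t_{i-1},0,t_i,\dots,t_{n-1})$, $B_iT(t_1,\dots,t_{n-1})=T(t_1,\dots,t_{i-1},1,t_i,\dots,t_{n-1})$, $\partial_n T=\sum_{i=1}^n(-1)^i(A_iT-B_iT)$ (with $\partial_n=0$ for $n\le0$); this induces a boundary map on $dC_\bullet(X)$ with $\partial\partial=0$, and $dH_n(X)=\ker\partial_n/\operatorname{im}\partial_{n+1}$ is the homology of $(dC_\bullet(X),\partial)$. *)

theory Defs
  imports "HOL-Algebra.Free_Abelian_Groups" "HOL-Algebra.Product_Groups"
begin

text \<open>
  Points of \<open>\<int>\<^sup>d\<close> are integer lists of length \<open>d\<close>, so that the spaces
  \<open>\<int>\<^sup>d\<close> of all dimensions live in one type; \<open>I\<^sup>0\<close> is the single point \<open>[]\<close>.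
  Coordinates are numbered from 1 in the mathematics and from 0 in lists.
\<close>

type_synonym point = "int list"
type_synonym adjacency = "point \<Rightarrow> point \<Rightarrow> bool"

definition c_adj :: "nat \<Rightarrow> adjacency" where
  "c_adj l p q \<longleftrightarrow>
     length p = length q \<and> p \<noteq> q \<and>
     card {i. i < length p \<and> \<bar>p ! i - q ! i\<bar> = 1} \<le> l \<and>
     (\<forall>i < length p. \<bar>p ! i - q ! i\<bar> = 1 \<or> p ! i = q ! i)"

definition digital_image :: "nat \<Rightarrow> nat \<Rightarrow> point set \<Rightarrow> bool" where
  "digital_image d l X \<longleftrightarrow>
     1 \<le> l \<and> l \<le> d \<and> finite X \<and> X \<subseteq> {p. length p = d}"

definition digitally_continuous ::
    "adjacency \<Rightarrow> adjacency \<Rightarrow> point set \<Rightarrow> point set \<Rightarrow> (point \<Rightarrow> point) \<Rightarrow> bool" where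
  "digitally_continuous \<kappa> \<mu> X Y f \<longleftrightarrow>
     f \<in> X \<rightarrow> Y \<and>
     (\<forall>x0 \<in> X. \<forall>x1 \<in> X. \<kappa> x0 x1 \<longrightarrow> f x0 = f x1 \<or> \<mu> (f x0) (f x1))"

definition digital_path ::
    "adjacency \<Rightarrow> point set \<Rightarrow> point \<Rightarrow> point \<Rightarrow> nat \<Rightarrow> (nat \<Rightarrow> point) \<Rightarrow> bool" where
  "digital_path \<kappa> X x y m f \<longleftrightarrow>
     f \<in> {0..m} \<rightarrow> X \<and> f 0 = x \<and> f m = y \<and>
     (\<forall>t < m. f t = f (Suc t) \<or> \<kappa> (f t) (f (Suc t)))"

definition digitally_connected :: "adjacency \<Rightarrow> point set \<Rightarrow> bool" where
  "digitally_connected \<kappa> A \<longleftrightarrow>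
     (\<forall>x \<in> A. \<forall>y \<in> A. x \<noteq> y \<longrightarrow> (\<exists>m f. digital_path \<kappa> A x y m f))"

definition digital_components :: "adjacency \<Rightarrow> point set \<Rightarrow> point set set" where
  "digital_components \<kappa> X =
     {A. A \<subseteq> X \<and> digitally_connected \<kappa> A \<and>
         (\<forall>B. A \<subseteq> B \<and> B \<subseteq> X \<and> digitally_connected \<kappa> B \<longrightarrow> B = A)}"

definition unit_cube :: "nat \<Rightarrow> point set" where
  "unit_cube n = {t. length t = n \<and> set t \<subseteq> {0, 1}}"

text \<open>
  A map on \<open>I\<^sup>n\<close> is represented by its extensional function, so that distinct
  HOL functions are distinct cubes.
\<close>

definition digital_cubes :: "adjacency \<Rightarrow> point set \<Rightarrow> nat \<Rightarrow> (point \<Rightarrow> point) set" where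
  "digital_cubes \<kappa> X n =
     {T \<in> extensional (unit_cube n). digitally_continuous (c_adj 1) \<kappa> (unit_cube n) X T}"

definition degenerate_cube :: "nat \<Rightarrow> (point \<Rightarrow> point) \<Rightarrow> bool" where
  "degenerate_cube n T \<longleftrightarrow>
     (\<exists>i < n. \<forall>s \<in> unit_cube n. \<forall>t \<in> unit_cube n.
        (\<forall>j < n. j \<noteq> i \<longrightarrow> s ! j = t ! j) \<longrightarrow> T s = T t)"

text \<open>
  The face of the \<open>n\<close>-cube \<open>T\<close> obtained by fixing the \<open>i\<close>-th coordinate
  (\<open>1 \<le> i \<le> n\<close>) to \<open>e\<close>: \<open>A\<^sub>i T\<close> for \<open>e = 0\<close> and \<open>B\<^sub>i T\<close> for \<open>e = 1\<close>.
\<close>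

definition cube_face :: "nat \<Rightarrow> int \<Rightarrow> nat \<Rightarrow> (point \<Rightarrow> point) \<Rightarrow> point \<Rightarrow> point" where
  "cube_face n e i T =
     restrict (\<lambda>t. T (take (i - 1) t @ [e] @ drop (i - 1) t)) (unit_cube (n - 1))"

text \<open>
  The complexes are indexed by all integers. In negative degrees there are no
  cubes, so \<open>dQ\<close>, \<open>dD\<close> and \<open>dC\<close> are trivial there; for \<open>n \<le> 0\<close> the sum
  defining the boundary is empty, hence the boundary is zero.
\<close>

definition dQ :: "adjacency \<Rightarrow> point set \<Rightarrow> int \<Rightarrow> ((point \<Rightarrow> point) \<Rightarrow>\<^sub>0 int) monoid" where
  "dQ \<kappa> X n = free_Abelian_group (if n < 0 then {} else digital_cubes \<kappa> X (nat n))"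

definition dD :: "adjacency \<Rightarrow> point set \<Rightarrow> int \<Rightarrow> ((point \<Rightarrow> point) \<Rightarrow>\<^sub>0 int) set" where
  "dD \<kappa> X n =
     generate (dQ \<kappa> X n)
       (frag_of ` {T. 0 \<le> n \<and> T \<in> digital_cubes \<kappa> X (nat n) \<and> degenerate_cube (nat n) T})"

definition dC :: "adjacency \<Rightarrow> point set \<Rightarrow> int \<Rightarrow> ((point \<Rightarrow> point) \<Rightarrow>\<^sub>0 int) set monoid" where
  "dC \<kappa> X n = dQ \<kappa> X n Mod dD \<kappa> X n"

definition cube_boundary ::
    "int \<Rightarrow> ((point \<Rightarrow> point) \<Rightarrow>\<^sub>0 int) \<Rightarrow> ((point \<Rightarrow> point) \<Rightarrow>\<^sub>0 int)" where
  "cube_boundary n =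
     frag_extend (\<lambda>T. \<Sum>i = 1..nat n.
       frag_cmul ((-1) ^ i)
         (frag_of (cube_face (nat n) 0 i T) - frag_of (cube_face (nat n) 1 i T)))"

text \<open>
  The induced map \<open>dC\<^sub>n \<rightarrow> dC\<^sub>n\<^sub>-\<^sub>1\<close>. Since \<open>cube_boundary\<close> maps \<open>dD\<^sub>n\<close> into
  \<open>dD\<^sub>n\<^sub>-\<^sub>1\<close>, all representatives \<open>c\<close> of the coset \<open>C\<close> yield the same coset.
\<close>

definition dC_boundary ::
    "adjacency \<Rightarrow> point set \<Rightarrow> int \<Rightarrow>
     ((point \<Rightarrow> point) \<Rightarrow>\<^sub>0 int) set \<Rightarrow> ((point \<Rightarrow> point) \<Rightarrow>\<^sub>0 int) set" where
  "dC_boundary \<kappa> X n C =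
     the_elem ((\<lambda>c. dD \<kappa> X (n - 1) #>\<^bsub>dQ \<kappa> X (n - 1)\<^esub> cube_boundary n c) ` C)"

definition dH ::
    "adjacency \<Rightarrow> point set \<Rightarrow> int \<Rightarrow> ((point \<Rightarrow> point) \<Rightarrow>\<^sub>0 int) set set monoid" where
  "dH \<kappa> X n =
     (dC \<kappa> X n)\<lparr>carrier := kernel (dC \<kappa> X n) (dC \<kappa> X (n - 1)) (dC_boundary \<kappa> X n)\<rparr>
     Mod (dC_boundary \<kappa> X (n + 1) ` carrier (dC \<kappa> X (n + 1)))"

end

theory Submission
  imports Defs
begin

text \<open>
  The image of a cube is connected, because any two vertices of \<open>I\<^sup>n\<close> are joined by
  changing one coordinate after the other. Hence every cube of \<open>X\<close> lies in exactly
  one component, together with its faces, and restricting chains to the cubes of a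
  component commutes with the boundary and preserves degeneracy. The homomorphisms
  \<open>c \<mapsto> [c]\<close> and \<open>c \<mapsto> ([c|\<^sub>A])\<^sub>A\<close> from the group of chains with degenerate boundary
  onto \<open>dH\<^sub>n(X)\<close> and \<open>\<Oplus>\<^sub>A dH\<^sub>n(A)\<close> are surjective with the same kernel.
\<close>

section \<open>Cubes and their faces\<close>

text \<open>The cardinality bound 1 says that any two coordinates of difference one coincide, and
  \<open>p \<noteq> q\<close> supplies such a coordinate. Exhibiting this coordinate avoids counting
  in later arguments.\<close>

lemma c_adj_1_iff:
  "c_adj 1 p q \<longleftrightarrow> length p = length q \<and>
     (\<exists>i < length p. \<bar>p ! i - q ! i\<bar> = 1 \<and> (\<forall>j < length p. j \<noteq> i \<longrightarrow> p ! j = q ! j))"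
proof
  let ?S = "{i. i < length p \<and> \<bar>p ! i - q ! i\<bar> = 1}"
  assume L: "c_adj 1 p q"
  then have len: "length p = length q" and ne: "p \<noteq> q" and card: "card ?S \<le> 1"
    and all: "\<And>i. i < length p \<Longrightarrow> \<bar>p ! i - q ! i\<bar> = 1 \<or> p ! i = q ! i"
    by (auto simp: c_adj_def)
  obtain i where i: "i < length p" "p ! i \<noteq> q ! i"
    using len ne by (auto simp: list_eq_iff_nth_eq)
  have "j = i" if "j < length p" "p ! j \<noteq> q ! j" for j
    using card card_le_Suc0_iff_eq[of ?S] i that all by auto
  then show "length p = length q \<and>
     (\<exists>i < length p. \<bar>p ! i - q ! i\<bar> = 1 \<and> (\<forall>j < length p. j \<noteq> i \<longrightarrow> p ! j = q ! j))"
    using len i all by blast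
next
  assume R: "length p = length q \<and>
     (\<exists>i < length p. \<bar>p ! i - q ! i\<bar> = 1 \<and> (\<forall>j < length p. j \<noteq> i \<longrightarrow> p ! j = q ! j))"
  then obtain i where i: "i < length p" "\<bar>p ! i - q ! i\<bar> = 1"
    and eq: "\<And>j. j < length p \<Longrightarrow> j \<noteq> i \<Longrightarrow> p ! j = q ! j"
    by blast
  have "{j. j < length p \<and> \<bar>p ! j - q ! j\<bar> = 1} = {i}"
    using i eq by fastforce
  moreover have "p \<noteq> q"
    using i by auto
  ultimately show "c_adj 1 p q"
    using R i eq unfolding c_adj_def by (metis card.empty card.insert empty_iff finite.emptyI
        order_refl One_nat_def)
qed

text \<open>This is the face inclusion of cubes. Positions are counted from 0, so the face with
  index \<open>i\<close> uses \<open>k = i - 1\<close>.\<close>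

definition insert_at :: "nat \<Rightarrow> 'a \<Rightarrow> 'a list \<Rightarrow> 'a list" where
  "insert_at k e t = take k t @ [e] @ drop k t"

lemma length_insert_at [simp]: "length (insert_at k e t) = Suc (length t)"
  by (simp add: insert_at_def)

lemma nth_insert_at:
  assumes "k \<le> length t" "j \<le> length t"
  shows "insert_at k e t ! j = (if j < k then t ! j else if j = k then e else t ! (j - 1))"
  using assms by (auto simp: insert_at_def nth_append nth_Cons')

lemma insert_at_unit_cube:
  assumes "t \<in> unit_cube n" "e \<in> {0, 1}"
  shows "insert_at k e t \<in> unit_cube (Suc n)"
  using assms by (auto simp: unit_cube_def insert_at_def dest: in_set_takeD in_set_dropD)

text \<open>The coordinates from position \<open>k\<close> on move up by one. So the coordinate
  \<open>i\<close> in which \<open>s\<close> and \<open>t\<close> differ becomes \<open>i\<close> or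
  \<open>Suc i\<close>, and the inserted entries agree.\<close>

lemma c_adj_1_insert_at:
  assumes "c_adj 1 s t" "k \<le> length s"
  shows "c_adj 1 (insert_at k e s) (insert_at k e t)"
proof -
  obtain i where len: "length s = length t" and i: "i < length s" "\<bar>s ! i - t ! i\<bar> = 1"
    and eq: "\<And>j. j < length s \<Longrightarrow> j \<noteq> i \<Longrightarrow> s ! j = t ! j"
    using assms(1) unfolding c_adj_1_iff by blast
  show ?thesis
    unfolding c_adj_1_iff length_insert_at
  proof (intro conjI exI[of _ "if i < k then i else Suc i"] allI impI)
    fix j assume "j < Suc (length s)" "j \<noteq> (if i < k then i else Suc i)"
    then show "insert_at k e s ! j = insert_at k e t ! j"
      using assms(2) len eq[of j] eq[of "j - 1"] by (auto simp: nth_insert_at split: if_splits)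
  qed (use assms(2) len i in \<open>auto simp: nth_insert_at\<close>)
qed

lemma cube_face_eq:
  "cube_face n e i T = restrict (\<lambda>t. T (insert_at (i - 1) e t)) (unit_cube (n - 1))"
  by (simp add: cube_face_def insert_at_def)

text \<open>A face is the composite of \<open>T\<close> with an insertion map, which preserves
  vertices and adjacency. The bounds on \<open>i\<close> exclude \<open>n = 0\<close>, where
  \<open>n - 1\<close> would be truncated.\<close>

lemma cube_face_in_digital_cubes:
  assumes T: "T \<in> digital_cubes \<kappa> X n" and e: "e \<in> {0, 1}" and i: "1 \<le> i" "i \<le> n"
  shows "cube_face n e i T \<in> digital_cubes \<kappa> X (n - 1)"
proof -
  have ins: "insert_at (i - 1) e t \<in> unit_cube n" if "t \<in> unit_cube (n - 1)" for t
    using insert_at_unit_cube[OF that e, of "i - 1"] i by simp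
  have adj: "c_adj 1 (insert_at (i - 1) e s) (insert_at (i - 1) e t)"
    if "c_adj 1 s t" "s \<in> unit_cube (n - 1)" for s t
    using that i by (intro c_adj_1_insert_at) (auto simp: unit_cube_def)
  show ?thesis
    using T ins adj
    by (fastforce simp: digital_cubes_def digitally_continuous_def cube_face_eq)
qed

text \<open>The two insertions differ only in coordinate \<open>i\<close>, which \<open>T\<close>
  ignores. In the boundary of a degenerate cube this cancels the term of that direction.\<close>

lemma cube_face_eq_if_independent:
  assumes "0 < n"
    and indep: "\<forall>s \<in> unit_cube n. \<forall>t \<in> unit_cube n. (\<forall>j < n. j \<noteq> i \<longrightarrow> s ! j = t ! j) \<longrightarrow> T s = T t"
    and "i < n"
  shows "cube_face n 0 (Suc i) T = cube_face n 1 (Suc i) T"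
proof -
  have "T (insert_at i 0 t) = T (insert_at i 1 t)" if t: "t \<in> unit_cube (n - 1)" for t
  proof (rule indep[rule_format])
    show "insert_at i 0 t ! j = insert_at i 1 t ! j" if "j < n" "j \<noteq> i" for j
      using t that \<open>i < n\<close> by (auto simp: nth_insert_at unit_cube_def)
  qed (use insert_at_unit_cube[OF t] \<open>0 < n\<close> in auto)
  then show ?thesis
    using \<open>0 < n\<close> by (auto simp: cube_face_eq restrict_def)
qed

text \<open>Fixing another coordinate \<open>k\<close> leaves the ignored coordinate
  \<open>i\<close> free, so the face still ignores it. This handles the remaining terms in the
  boundary of a degenerate cube.\<close>

lemma degenerate_cube_face_if_independent:
  assumes indep: "\<forall>s \<in> unit_cube n. \<forall>t \<in> unit_cube n. (\<forall>j < n. j \<noteq> i \<longrightarrow> s ! j = t ! j) \<longrightarrow> T s = T t"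
    and "i < n" "k < n" "k \<noteq> i" "e \<in> {0, 1}"
  shows "degenerate_cube (n - 1) (cube_face n e (Suc k) T)"
proof -
  \<comment> \<open>The number of the ignored coordinate after coordinate \<open>k\<close> has been
    deleted.\<close>
  define i' where "i' = (if i < k then i else i - 1)"
  have T_eq: "T (insert_at k e s) = T (insert_at k e t)"
    if st: "s \<in> unit_cube (n - 1)" "t \<in> unit_cube (n - 1)"
      and eq: "\<forall>j < n - 1. j \<noteq> i' \<longrightarrow> s ! j = t ! j" for s t
  proof (rule indep[rule_format])
    show "insert_at k e s ! j = insert_at k e t ! j" if j: "j < n" "j \<noteq> i" for j
    proof -
      have len: "length s = n - 1" "length t = n - 1"
        using st by (auto simp: unit_cube_def)
      have "s ! j = t ! j" if "j < k"
        using that j \<open>k < n\<close> \<open>k \<noteq> i\<close> by (intro eq[rule_format]) (auto simp: i'_def)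
      moreover have "s ! (j - 1) = t ! (j - 1)" if "k < j"
        using that j \<open>k \<noteq> i\<close> by (intro eq[rule_format]) (auto simp: i'_def)
      ultimately show "insert_at k e s ! j = insert_at k e t ! j"
        using j \<open>k < n\<close> len by (auto simp: nth_insert_at)
    qed
  qed (use insert_at_unit_cube[of _ "n - 1" e k] assms(3,5) st in auto)
  show ?thesis
    unfolding degenerate_cube_def cube_face_eq
  proof (intro exI[of _ i'] conjI ballI impI)
    show "i' < n - 1"
      using assms(2-4) by (auto simp: i'_def)
  qed (simp only: restrict_apply' diff_Suc_1 T_eq)
qed

text \<open>A path between two vertices that changes at most one coordinate per step is carried by
  \<open>T\<close> to a path in the image.\<close>

lemma digitally_connected_cube:
  assumes T: "T \<in> digital_cubes \<kappa> X n"
  shows "digitally_connected \<kappa> (T ` unit_cube n)"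
  unfolding digitally_connected_def
proof (intro ballI impI)
  fix x y assume "x \<in> T ` unit_cube n" "y \<in> T ` unit_cube n"
  then obtain s t where st: "s \<in> unit_cube n" "t \<in> unit_cube n" and xy: "x = T s" "y = T t"
    by auto
  \<comment> \<open>After \<open>k\<close> steps the first \<open>k\<close> coordinates are already
    those of \<open>t\<close>, so the path runs from \<open>s\<close> at time 0 to \<open>t\<close>
    at time \<open>n\<close>.\<close>
  define f where "f k = take k t @ drop k s" for k
  have len: "length s = n" "length t = n"
    using st by (auto simp: unit_cube_def)
  have f: "f k \<in> unit_cube n" for k
    using st by (auto simp: f_def unit_cube_def dest: in_set_takeD in_set_dropD)
  have step: "f k = f (Suc k) \<or> c_adj 1 (f k) (f (Suc k))" if "k < n" for k
  proof (cases "s ! k = t ! k")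
    case True
    then have "f k = f (Suc k)"
      using that len by (simp add: f_def take_Suc_conv_app_nth flip: Cons_nth_drop_Suc)
    then show ?thesis ..
  next
    case False
    \<comment> \<open>Both entries are 0 or 1, so being unequal they differ by exactly one.\<close>
    have "s ! k \<in> set s" "t ! k \<in> set t" "set s \<subseteq> {0, 1}" "set t \<subseteq> {0, 1}"
      using st that len by (simp_all add: unit_cube_def)
    then have "s ! k \<in> {0, 1}" "t ! k \<in> {0, 1}"
      by blast+
    then have "\<bar>f k ! k - f (Suc k) ! k\<bar> = 1"
      using False that len by (auto simp: f_def nth_append)
    moreover have "f k ! j = f (Suc k) ! j" if "j < n" "j \<noteq> k" for j
      using that \<open>k < n\<close> len by (auto simp: f_def nth_append)
    ultimately have "c_adj 1 (f k) (f (Suc k))"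
      using that f[of k] f[of "Suc k"] unfolding c_adj_1_iff by (auto simp: unit_cube_def)
    then show ?thesis ..
  qed
  have "digital_path \<kappa> (T ` unit_cube n) x y n (T \<circ> f)"
    unfolding digital_path_def
  proof (intro conjI allI impI)
    fix k assume "k < n"
    then show "(T \<circ> f) k = (T \<circ> f) (Suc k) \<or> \<kappa> ((T \<circ> f) k) ((T \<circ> f) (Suc k))"
      using step[of k] T f by (auto simp: digital_cubes_def digitally_continuous_def)
  qed (use f xy len in \<open>auto simp: f_def\<close>)
  then show "\<exists>m g. digital_path \<kappa> (T ` unit_cube n) x y m g"
    by blast
qed

section \<open>Components\<close>

lemma digital_path_mono:
  "digital_path \<kappa> A x y m f \<Longrightarrow> A \<subseteq> B \<Longrightarrow> digital_path \<kappa> B x y m f"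
  by (auto simp: digital_path_def)

lemma digital_path_trans:
  assumes f: "digital_path \<kappa> A x y m f" and g: "digital_path \<kappa> A y z k g"
  shows "digital_path \<kappa> A x z (m + k) (\<lambda>t. if t \<le> m then f t else g (t - m))"
  unfolding digital_path_def
proof (intro conjI allI impI)
  fix t assume t: "t < m + k"
  consider "t < m" | "t = m" | "m < t" by linarith
  then show "(if t \<le> m then f t else g (t - m)) = (if Suc t \<le> m then f (Suc t) else g (Suc t - m)) \<or>
    \<kappa> (if t \<le> m then f t else g (t - m)) (if Suc t \<le> m then f (Suc t) else g (Suc t - m))"
  proof cases
    \<comment> \<open>The junction of the paths: \<open>f m\<close> and \<open>g 0\<close> are both
      \<open>y\<close>, so this step is the first step of \<open>g\<close>.\<close>
    case 2
    then show ?thesis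
      using f g t by (auto simp: digital_path_def)
  next
    case 3
    then have "t - m < k" "Suc t - m = Suc (t - m)"
      using t by auto
    then show ?thesis
      using g 3 by (auto simp: digital_path_def)
  qed (use f in \<open>auto simp: digital_path_def\<close>)
qed (use f g in \<open>auto simp: digital_path_def Pi_iff\<close>)

text \<open>Connectedness is defined by paths between distinct points; a constant path of length 0
  covers equal points.\<close>

lemma digitally_connected_path:
  assumes "digitally_connected \<kappa> A" "x \<in> A" "y \<in> A"
  shows "\<exists>m f. digital_path \<kappa> A x y m f"
proof (cases "x = y")
  case True
  then have "digital_path \<kappa> A x y 0 (\<lambda>_. x)"
    using assms by (simp add: digital_path_def)
  then show ?thesis
    by blast
qed (use assms in \<open>auto simp: digitally_connected_def\<close>)

text \<open>Any two points are joined by a path through the common point \<open>p\<close>.\<close>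

lemma digitally_connected_Un:
  assumes A: "digitally_connected \<kappa> A" and B: "digitally_connected \<kappa> B" and p: "p \<in> A" "p \<in> B"
  shows "digitally_connected \<kappa> (A \<union> B)"
proof -
  have "\<exists>m f. digital_path \<kappa> (A \<union> B) x y m f" if "x \<in> A \<union> B" "y \<in> A \<union> B" for x y
  proof -
    have "\<exists>m f. digital_path \<kappa> (A \<union> B) x p m f" "\<exists>m f. digital_path \<kappa> (A \<union> B) p y m f"
      using that digitally_connected_path[OF A] digitally_connected_path[OF B] p
      by (meson UnE digital_path_mono Un_upper1 Un_upper2)+
    then show ?thesis
      using digital_path_trans by blast
  qed
  then show ?thesis
    by (simp add: digitally_connected_def)
qed

text \<open>The union of two components that meet is connected, so by maximality it equals each of
  them.\<close>

lemma digital_components_eq: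
  assumes A: "A \<in> digital_components \<kappa> X" and B: "B \<in> digital_components \<kappa> X"
    and p: "p \<in> A" "p \<in> B"
  shows "A = B"
proof -
  have "digitally_connected \<kappa> (A \<union> B)" "A \<union> B \<subseteq> X"
    using A B p by (auto simp: digital_components_def intro: digitally_connected_Un)
  then have "A \<union> B = A" "A \<union> B = B"
    using A B Un_upper1[of A B] Un_upper2[of B A] unfolding digital_components_def mem_Collect_eq
    by metis+
  then show ?thesis
    by simp
qed

text \<open>A finite \<open>X\<close> has finitely many connected subsets, so some maximal one lies
  above \<open>S\<close>. Its maximality among all connected subsets makes it a component.\<close>

lemma digitally_connected_subset_component:
  assumes "finite X" "S \<subseteq> X" "digitally_connected \<kappa> S"
  obtains A where "A \<in> digital_components \<kappa> X" "S \<subseteq> A"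
proof -
  let ?F = "{A. A \<subseteq> X \<and> digitally_connected \<kappa> A}"
  have "finite ?F" "S \<in> ?F"
    using assms by auto
  then obtain A where A: "A \<in> ?F" "S \<subseteq> A" and max: "\<forall>B \<in> ?F. A \<subseteq> B \<longrightarrow> A = B"
    using finite_has_maximal2[of ?F S] by blast
  have "B = A" if "A \<subseteq> B \<and> B \<subseteq> X \<and> digitally_connected \<kappa> B" for B
    using max[rule_format, of B] that by simp
  then have "A \<in> digital_components \<kappa> X"
    using A(1) unfolding digital_components_def by blast
  then show thesis
    using A(2) that by blast
qed

lemma finite_digital_components: "finite X \<Longrightarrow> finite (digital_components \<kappa> X)"
  by (rule finite_subset[of _ "Pow X"]) (auto simp: digital_components_def)

section \<open>Homology classes of cycles\<close>

lemma (in group) r_coset_eq_iff: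
  assumes "subgroup H G" "x \<in> carrier G" "y \<in> carrier G"
  shows "H #> x = H #> y \<longleftrightarrow> x \<otimes> inv y \<in> H"
  using assms by (metis is_group rcos_self repr_independence subgroup.rcos_module)

text \<open>By the first isomorphism theorem both groups are the quotient of \<open>G\<close> by the
  same kernel. This yields an isomorphism without a well-definedness argument for a map from
  \<open>H\<close> to \<open>K\<close>.\<close>

lemma iso_if_kernel_eq:
  assumes h: "group_hom G H h" "h ` carrier G = carrier H"
    and k: "group_hom G K k" "k ` carrier G = carrier K"
    and eq: "kernel G H h = kernel G K k"
  shows "H \<cong> K"
proof -
  have "G Mod kernel G H h \<cong> H" "G Mod kernel G H h \<cong> K"
    using group_hom.FactGroup_iso[OF h] group_hom.FactGroup_iso[OF k] eq by simp_all
  moreover have "group (G Mod kernel G H h)"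
    using normal.factorgroup_is_group[OF group_hom.normal_kernel[OF h(1)]] .
  ultimately show ?thesis
    by (metis group.iso_sym iso_trans)
qed

lemma subgroup_free_Abelian_group:
  assumes "S \<subseteq> U"
  shows "subgroup {c. Poly_Mapping.keys c \<subseteq> S} (free_Abelian_group U)"
proof (rule group.subgroupI)
  show "{c. Poly_Mapping.keys c \<subseteq> S} \<noteq> {}"
    by (auto intro: exI[of _ 0])
qed (use assms in \<open>auto simp: inv_free_Abelian_group[OF order_trans] dest: subsetD[OF keys_add]\<close>)

text \<open>Chains supported on \<open>S\<close> form a subgroup that contains the generators;
  conversely each of them arises from basis elements by differences. Membership in \<open>dD\<close>
  thereby becomes a condition on supports.\<close>

lemma generate_free_Abelian_group:
  assumes "S \<subseteq> U"
  shows "generate (free_Abelian_group U) (frag_of ` S) = {c. Poly_Mapping.keys c \<subseteq> S}"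
proof
  show "generate (free_Abelian_group U) (frag_of ` S) \<subseteq> {c. Poly_Mapping.keys c \<subseteq> S}"
    by (rule group.generate_subgroup_incl) (use subgroup_free_Abelian_group[OF assms] in auto)
next
  let ?F = "free_Abelian_group U"
  have sub: "subgroup (generate ?F (frag_of ` S)) ?F"
    using assms by (intro group.generate_is_subgroup) auto
  have "c \<in> generate ?F (frag_of ` S)" if "Poly_Mapping.keys c \<subseteq> S" for c
    using that
  proof (induction c rule: frag_induction)
    case zero
    then show ?case
      using subgroup.one_closed[OF sub] by simp
  next
    case (one x)
    then show ?case
      by (auto intro: generate.incl)
  next
    case (diff a b)
    \<comment> \<open>The inverse in the free group is known to be the negative only for elements of
      the carrier.\<close>
    have "Poly_Mapping.keys b \<subseteq> U"
      using diff.IH(2) subgroup.mem_carrier[OF sub] by auto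
    then show ?case
      using subgroup.m_closed[OF sub diff.IH(1) subgroup.m_inv_closed[OF sub diff.IH(2)]] by simp
  qed
  then show "{c. Poly_Mapping.keys c \<subseteq> S} \<subseteq> generate ?F (frag_of ` S)"
    by blast
qed

section \<open>Chains, degenerate chains and the boundary\<close>

definition graded_cubes :: "adjacency \<Rightarrow> point set \<Rightarrow> int \<Rightarrow> (point \<Rightarrow> point) set" where
  "graded_cubes \<kappa> X n = (if n < 0 then {} else digital_cubes \<kappa> X (nat n))"

definition degenerate_cubes :: "adjacency \<Rightarrow> point set \<Rightarrow> int \<Rightarrow> (point \<Rightarrow> point) set" where
  "degenerate_cubes \<kappa> X n = {T \<in> graded_cubes \<kappa> X n. degenerate_cube (nat n) T}"

lemma degenerate_cubes_subset: "degenerate_cubes \<kappa> X n \<subseteq> graded_cubes \<kappa> X n"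
  by (auto simp: degenerate_cubes_def)

lemma dQ_eq: "dQ \<kappa> X n = free_Abelian_group (graded_cubes \<kappa> X n)"
  by (simp add: dQ_def graded_cubes_def)

lemma dD_eq: "dD \<kappa> X n = {c. Poly_Mapping.keys c \<subseteq> degenerate_cubes \<kappa> X n}"
proof -
  have "{T. 0 \<le> n \<and> T \<in> digital_cubes \<kappa> X (nat n) \<and> degenerate_cube (nat n) T} = degenerate_cubes \<kappa> X n"
    by (auto simp: degenerate_cubes_def graded_cubes_def)
  then show ?thesis
    by (simp add: dD_def dQ_eq generate_free_Abelian_group[OF degenerate_cubes_subset])
qed

lemma cube_boundary_simps [simp]:
  "cube_boundary n 0 = 0"
  "cube_boundary n (a + b) = cube_boundary n a + cube_boundary n b"
  "cube_boundary n (a - b) = cube_boundary n a - cube_boundary n b"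
  by (simp_all add: cube_boundary_def frag_extend_add frag_extend_diff)

lemma cube_boundary_sum:
  "finite I \<Longrightarrow> cube_boundary n (\<Sum>i\<in>I. c i) = (\<Sum>i\<in>I. cube_boundary n (c i))"
  by (simp add: cube_boundary_def frag_extend_sum o_def)

lemma cube_boundary_frag_of:
  "cube_boundary n (frag_of T) = (\<Sum>i = 1..nat n. frag_cmul ((-1) ^ i)
     (frag_of (cube_face (nat n) 0 i T) - frag_of (cube_face (nat n) 1 i T)))"
  by (simp add: cube_boundary_def)

text \<open>An index in \<open>{1..nat n}\<close> forces \<open>n\<close> to be positive, so
  \<open>nat n - 1\<close> and \<open>nat (n - 1)\<close> agree.\<close>

lemma cube_face_in_graded_cubes:
  assumes "T \<in> graded_cubes \<kappa> X n" "i \<in> {1..nat n}" "e \<in> {0, 1}"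
  shows "cube_face (nat n) e i T \<in> graded_cubes \<kappa> X (n - 1)"
  using assms cube_face_in_digital_cubes[of T \<kappa> X "nat n" e i]
  by (auto simp: graded_cubes_def nat_diff_distrib split: if_splits)

lemma keys_sum_subset:
  assumes "\<And>i. i \<in> I \<Longrightarrow> Poly_Mapping.keys (f i) \<subseteq> S"
  shows "Poly_Mapping.keys (sum f I) \<subseteq> S"
  using keys_sum[of f I] assms by blast

lemma keys_diff_subset:
  assumes "Poly_Mapping.keys a \<subseteq> S" "Poly_Mapping.keys b \<subseteq> S"
  shows "Poly_Mapping.keys (a - b) \<subseteq> S"
  using keys_diff[of a b] assms by blast

lemma keys_add_subset:
  assumes "Poly_Mapping.keys a \<subseteq> S" "Poly_Mapping.keys b \<subseteq> S"
  shows "Poly_Mapping.keys (a + b) \<subseteq> S"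
  using keys_add[of a b] assms by blast

lemma keys_cube_boundary:
  assumes "Poly_Mapping.keys c \<subseteq> graded_cubes \<kappa> X n"
  shows "Poly_Mapping.keys (cube_boundary n c) \<subseteq> graded_cubes \<kappa> X (n - 1)"
  using assms
proof (induction c rule: frag_induction)
  case (one T)
  show ?case
    unfolding cube_boundary_frag_of
    by (intro keys_sum_subset order_trans[OF keys_cmul] keys_diff_subset)
      (use one cube_face_in_graded_cubes in \<open>auto simp: keys_frag_of\<close>)
qed (simp_all add: keys_diff_subset)

text \<open>In the direction that the cube ignores, opposite faces cancel; in every other direction
  both faces are degenerate.\<close>

lemma keys_cube_boundary_degenerate:
  assumes "Poly_Mapping.keys c \<subseteq> degenerate_cubes \<kappa> X n"
  shows "Poly_Mapping.keys (cube_boundary n c) \<subseteq> degenerate_cubes \<kappa> X (n - 1)"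
  using assms
proof (induction c rule: frag_induction)
  case (one T)
  then obtain i where i: "i < nat n"
    and indep: "\<forall>s \<in> unit_cube (nat n). \<forall>t \<in> unit_cube (nat n).
      (\<forall>j < nat n. j \<noteq> i \<longrightarrow> s ! j = t ! j) \<longrightarrow> T s = T t"
    unfolding degenerate_cubes_def degenerate_cube_def by blast
  have T: "T \<in> graded_cubes \<kappa> X n"
    using one by (simp add: degenerate_cubes_def)
  let ?d = "\<lambda>j. frag_of (cube_face (nat n) 0 j T) - frag_of (cube_face (nat n) 1 j T)"
  have "Poly_Mapping.keys (?d j) \<subseteq> degenerate_cubes \<kappa> X (n - 1)" if j: "j \<in> {1..nat n}" for j
  proof (cases "j = Suc i")
    case True
    then show ?thesis
      using cube_face_eq_if_independent[OF _ indep i] i by simp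
  next
    case False
    have "cube_face (nat n) e j T \<in> degenerate_cubes \<kappa> X (n - 1)" if e: "e \<in> {0, 1}" for e
    proof -
      \<comment> \<open>Faces are numbered from 1 but coordinates from 0, hence the index
        \<open>Suc (j - 1)\<close>.\<close>
      have "degenerate_cube (nat n - 1) (cube_face (nat n) e (Suc (j - 1)) T)"
        by (rule degenerate_cube_face_if_independent[OF indep i]) (use False j e in auto)
      moreover have "nat n - 1 = nat (n - 1)" "Suc (j - 1) = j"
        using j by auto
      ultimately show ?thesis
        using cube_face_in_graded_cubes[OF T j e] by (simp add: degenerate_cubes_def)
    qed
    then show ?thesis
      by (intro keys_diff_subset) (auto simp: keys_frag_of)
  qed
  then show ?case
    unfolding cube_boundary_frag_of
    by (intro keys_sum_subset order_trans[OF keys_cmul])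
qed (simp_all add: keys_diff_subset)

section \<open>The quotient by degenerate chains\<close>

lemma group_dQ [simp]: "group (dQ \<kappa> X n)"
  by (simp add: dQ_eq)

lemma subgroup_dD: "subgroup (dD \<kappa> X n) (dQ \<kappa> X n)"
  by (simp add: dQ_eq dD_eq subgroup_free_Abelian_group degenerate_cubes_subset)

lemma normal_dD: "dD \<kappa> X n \<lhd> dQ \<kappa> X n"
  unfolding dQ_eq
  by (intro comm_group.subgroup_imp_normal abelian_free_Abelian_group subgroup_dD[unfolded dQ_eq])

lemma comm_group_dC: "comm_group (dC \<kappa> X n)"
  unfolding dC_def
  by (intro comm_group.abelian_FactGroup subgroup_dD) (simp add: dQ_eq abelian_free_Abelian_group)

lemma hom_dQ_dC: "(\<lambda>c. dD \<kappa> X n #>\<^bsub>dQ \<kappa> X n\<^esub> c) \<in> hom (dQ \<kappa> X n) (dC \<kappa> X n)"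
  unfolding dC_def by (rule normal.r_coset_hom_Mod[OF normal_dD])

lemma dD_coset_eq_iff:
  assumes "a \<in> carrier (dQ \<kappa> X n)" "b \<in> carrier (dQ \<kappa> X n)"
  shows "dD \<kappa> X n #>\<^bsub>dQ \<kappa> X n\<^esub> a = dD \<kappa> X n #>\<^bsub>dQ \<kappa> X n\<^esub> b \<longleftrightarrow> a - b \<in> dD \<kappa> X n"
  using group.r_coset_eq_iff[OF group_dQ subgroup_dD assms] assms by (simp add: dQ_eq)

text \<open>Elements of one coset differ by a degenerate chain, whose boundary is again degenerate.
  So the set of values in the definition is a singleton, and \<open>the_elem\<close> returns the
  value at any representative.\<close>

lemma dC_boundary_coset:
  assumes c: "c \<in> carrier (dQ \<kappa> X n)"
  shows "dC_boundary \<kappa> X n (dD \<kappa> X n #>\<^bsub>dQ \<kappa> X n\<^esub> c) =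
    dD \<kappa> X (n - 1) #>\<^bsub>dQ \<kappa> X (n - 1)\<^esub> cube_boundary n c"
proof -
  let ?C = "dD \<kappa> X n #>\<^bsub>dQ \<kappa> X n\<^esub> c"
  have "dD \<kappa> X (n - 1) #>\<^bsub>dQ \<kappa> X (n - 1)\<^esub> cube_boundary n c' =
      dD \<kappa> X (n - 1) #>\<^bsub>dQ \<kappa> X (n - 1)\<^esub> cube_boundary n c" if c'_in: "c' \<in> ?C" for c'
  proof -
    obtain h where h: "h \<in> dD \<kappa> X n" and c': "c' = h + c"
      using c'_in by (auto simp: r_coset_def dQ_eq)
    have "h \<in> carrier (dQ \<kappa> X n)"
      using h subgroup.mem_carrier[OF subgroup_dD] by blast
    then have "c' \<in> carrier (dQ \<kappa> X n)"
      using c c' by (simp add: dQ_eq keys_add_subset)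
    moreover have "cube_boundary n c' - cube_boundary n c \<in> dD \<kappa> X (n - 1)"
      using h keys_cube_boundary_degenerate by (auto simp: c' dD_eq)
    ultimately show ?thesis
      using c by (intro dD_coset_eq_iff[THEN iffD2]) (simp_all add: dQ_eq keys_cube_boundary)
  qed
  moreover have "c \<in> ?C"
    using c group.rcos_self[OF group_dQ _ subgroup_dD] by blast
  ultimately have "(\<lambda>c. dD \<kappa> X (n - 1) #>\<^bsub>dQ \<kappa> X (n - 1)\<^esub> cube_boundary n c) ` ?C =
      {dD \<kappa> X (n - 1) #>\<^bsub>dQ \<kappa> X (n - 1)\<^esub> cube_boundary n c}"
    by blast
  then show ?thesis
    by (simp add: dC_boundary_def)
qed

text \<open>Cycles are described by chains before passing to cosets: the kernel of the boundary on
  \<open>dC\<close> consists of the cosets of these chains.\<close>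

definition chain_cycles :: "adjacency \<Rightarrow> point set \<Rightarrow> int \<Rightarrow> ((point \<Rightarrow> point) \<Rightarrow>\<^sub>0 int) set" where
  "chain_cycles \<kappa> X n = {c \<in> carrier (dQ \<kappa> X n). cube_boundary n c \<in> dD \<kappa> X (n - 1)}"

definition dC_boundaries :: "adjacency \<Rightarrow> point set \<Rightarrow> int \<Rightarrow> ((point \<Rightarrow> point) \<Rightarrow>\<^sub>0 int) set set" where
  "dC_boundaries \<kappa> X n = dC_boundary \<kappa> X (n + 1) ` carrier (dC \<kappa> X (n + 1))"

text \<open>Passing to cosets twice, modulo degenerate chains and then modulo boundaries, makes
  sense for every chain and gives a homomorphism on all of \<open>dQ\<close>; elements of
  \<open>dH\<close> arise from \<open>chain_cycles\<close>.\<close>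

definition homology_class ::
    "adjacency \<Rightarrow> point set \<Rightarrow> int \<Rightarrow> ((point \<Rightarrow> point) \<Rightarrow>\<^sub>0 int) \<Rightarrow> ((point \<Rightarrow> point) \<Rightarrow>\<^sub>0 int) set set" where
  "homology_class \<kappa> X n c =
     dC_boundaries \<kappa> X n #>\<^bsub>dC \<kappa> X n\<^esub> (dD \<kappa> X n #>\<^bsub>dQ \<kappa> X n\<^esub> c)"

lemma carrier_dC: "carrier (dC \<kappa> X n) = (\<lambda>c. dD \<kappa> X n #>\<^bsub>dQ \<kappa> X n\<^esub> c) ` carrier (dQ \<kappa> X n)"
  by (auto simp: dC_def FactGroup_def RCOSETS_def)

lemma dC_boundaries_eq:
  "dC_boundaries \<kappa> X n =
     (\<lambda>u. dD \<kappa> X n #>\<^bsub>dQ \<kappa> X n\<^esub> cube_boundary (n + 1) u) ` carrier (dQ \<kappa> X (n + 1))"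
  unfolding dC_boundaries_def carrier_dC image_image
  by (intro image_cong refl) (simp add: dC_boundary_coset)

text \<open>The set is the image of all chains of degree \<open>n + 1\<close> under
  \<open>cube_boundary\<close> followed by the coset map, a composite of homomorphisms.\<close>

lemma subgroup_dC_boundaries: "subgroup (dC_boundaries \<kappa> X n) (dC \<kappa> X n)"
proof -
  have "cube_boundary (n + 1) \<in> hom (dQ \<kappa> X (n + 1)) (dQ \<kappa> X n)"
    using keys_cube_boundary[of _ \<kappa> X "n + 1"] by (intro homI) (auto simp: dQ_eq)
  then have "(\<lambda>c. dD \<kappa> X n #>\<^bsub>dQ \<kappa> X n\<^esub> c) \<circ> cube_boundary (n + 1) \<in> hom (dQ \<kappa> X (n + 1)) (dC \<kappa> X n)"
    using hom_dQ_dC by (rule hom_compose)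
  then have "group_hom (dQ \<kappa> X (n + 1)) (dC \<kappa> X n)
      ((\<lambda>c. dD \<kappa> X n #>\<^bsub>dQ \<kappa> X n\<^esub> c) \<circ> cube_boundary (n + 1))"
    using comm_group_dC by (simp add: group_hom_def group_hom_axioms_def comm_group_def)
  then show ?thesis
    using group_hom.img_is_subgroup by (fastforce simp: dC_boundaries_eq o_def)
qed

lemma subgroup_chain_cycles: "subgroup (chain_cycles \<kappa> X n) (dQ \<kappa> X n)"
proof -
  have "{c. Poly_Mapping.keys c \<subseteq> graded_cubes \<kappa> X n \<and>
       Poly_Mapping.keys (cube_boundary n c) \<subseteq> degenerate_cubes \<kappa> X (n - 1)} = chain_cycles \<kappa> X n"
    by (simp add: chain_cycles_def dQ_eq dD_eq)
  \<comment> \<open>Inverses in \<open>dQ\<close> are negatives, so this gives closure under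
    inverses.\<close>
  moreover have "cube_boundary n (- c) = - cube_boundary n c" for c
    using cube_boundary_simps(3)[of n 0 c] by simp
  ultimately show ?thesis
    by (intro group.subgroupI)
      (auto simp: dQ_eq dD_eq chain_cycles_def keys_add_subset intro: exI[of _ 0])
qed

lemma group_hom_homology_class:
  "group_hom (dQ \<kappa> X n) (dC \<kappa> X n Mod dC_boundaries \<kappa> X n) (homology_class \<kappa> X n)"
proof -
  interpret C: comm_group "dC \<kappa> X n"
    by (rule comm_group_dC)
  have normal: "dC_boundaries \<kappa> X n \<lhd> dC \<kappa> X n"
    by (intro C.subgroup_imp_normal subgroup_dC_boundaries)
  have "(\<lambda>C. dC_boundaries \<kappa> X n #>\<^bsub>dC \<kappa> X n\<^esub> C) \<circ> (\<lambda>c. dD \<kappa> X n #>\<^bsub>dQ \<kappa> X n\<^esub> c)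
      \<in> hom (dQ \<kappa> X n) (dC \<kappa> X n Mod dC_boundaries \<kappa> X n)"
    by (intro hom_compose[OF hom_dQ_dC] normal.r_coset_hom_Mod normal)
  then show ?thesis
    using normal.factorgroup_is_group[OF normal]
    by (simp add: group_hom_def group_hom_axioms_def homology_class_def[abs_def] o_def)
qed

text \<open>
  Replacing the kernel by the image of its elements in the quotient of the whole
  group \<open>dC\<^sub>n\<close> makes this a group without appeal to \<open>\<partial>\<partial> = 0\<close>.
\<close>

lemma dH_eq:
  "dH \<kappa> X n = (dC \<kappa> X n Mod dC_boundaries \<kappa> X n)
     \<lparr>carrier := homology_class \<kappa> X n ` chain_cycles \<kappa> X n\<rparr>"
proof -
  have cyc: "dC_boundary \<kappa> X n (dD \<kappa> X n #>\<^bsub>dQ \<kappa> X n\<^esub> c) = \<one>\<^bsub>dC \<kappa> X (n - 1)\<^esub> \<longleftrightarrow>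
      cube_boundary n c \<in> dD \<kappa> X (n - 1)" if c: "c \<in> carrier (dQ \<kappa> X n)" for c
  proof -
    \<comment> \<open>The unit is written as the coset of 0 so that the criterion for equal cosets
      applies.\<close>
    have one: "\<one>\<^bsub>dC \<kappa> X (n - 1)\<^esub> = dD \<kappa> X (n - 1) #>\<^bsub>dQ \<kappa> X (n - 1)\<^esub> 0"
      by (simp add: dC_def FactGroup_def r_coset_def dQ_eq)
    have "cube_boundary n c \<in> carrier (dQ \<kappa> X (n - 1))" "0 \<in> carrier (dQ \<kappa> X (n - 1))"
      using c by (simp_all add: dQ_eq keys_cube_boundary)
    then show ?thesis
      using c by (simp add: dC_boundary_coset one dD_coset_eq_iff)
  qed
  have "kernel (dC \<kappa> X n) (dC \<kappa> X (n - 1)) (dC_boundary \<kappa> X n) =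
      (\<lambda>c. dD \<kappa> X n #>\<^bsub>dQ \<kappa> X n\<^esub> c) ` chain_cycles \<kappa> X n"
    using cyc by (auto simp: kernel_def carrier_dC chain_cycles_def)
  \<comment> \<open>Cosets and their products depend on the multiplication only, so restricting the
    carrier of \<open>dC\<close> before forming the quotient does not change them.\<close>
  then show ?thesis
    by (auto simp: dH_def FactGroup_def RCOSETS_def homology_class_def r_coset_def set_mult_def
        fun_eq_iff simp flip: dC_boundaries_def)
qed

lemma group_hom_cycles_dH:
  "group_hom ((dQ \<kappa> X n)\<lparr>carrier := chain_cycles \<kappa> X n\<rparr>) (dH \<kappa> X n) (homology_class \<kappa> X n)"
proof -
  interpret h: group_hom "dQ \<kappa> X n" "dC \<kappa> X n Mod dC_boundaries \<kappa> X n" "homology_class \<kappa> X n"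
    by (rule group_hom_homology_class)
  have "group (dH \<kappa> X n)"
    unfolding dH_eq
    by (intro h.H.subgroup_imp_group h.subgroup_img_is_subgroup subgroup_chain_cycles)
  moreover have "group ((dQ \<kappa> X n)\<lparr>carrier := chain_cycles \<kappa> X n\<rparr>)"
    by (intro h.G.subgroup_imp_group subgroup_chain_cycles)
  moreover have "homology_class \<kappa> X n \<in> hom ((dQ \<kappa> X n)\<lparr>carrier := chain_cycles \<kappa> X n\<rparr>) (dH \<kappa> X n)"
    using subgroup.mem_carrier[OF subgroup_chain_cycles] by (intro homI) (auto simp: dH_eq h.hom_mult)
  ultimately show ?thesis
    by (simp add: group_hom_def group_hom_axioms_def)
qed

lemma carrier_dH: "carrier (dH \<kappa> X n) = homology_class \<kappa> X n ` chain_cycles \<kappa> X n"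
  by (simp add: dH_eq)

text \<open>The unit of the quotient is the subgroup of boundaries itself, and a coset equals it
  exactly when its representative lies in it. Triviality in homology thus becomes a statement about
  chains.\<close>

lemma homology_class_eq_one_iff:
  assumes c: "c \<in> carrier (dQ \<kappa> X n)"
  shows "homology_class \<kappa> X n c = \<one>\<^bsub>dH \<kappa> X n\<^esub> \<longleftrightarrow>
    (\<exists>u \<in> carrier (dQ \<kappa> X (n + 1)). c - cube_boundary (n + 1) u \<in> dD \<kappa> X n)"
proof -
  interpret C: comm_group "dC \<kappa> X n"
    by (rule comm_group_dC)
  have "\<one>\<^bsub>dH \<kappa> X n\<^esub> = dC_boundaries \<kappa> X n"
    by (simp add: dH_eq FactGroup_def)
  moreover have "dD \<kappa> X n #>\<^bsub>dQ \<kappa> X n\<^esub> c \<in> carrier (dC \<kappa> X n)"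
    using c by (auto simp: carrier_dC)
  ultimately have "homology_class \<kappa> X n c = \<one>\<^bsub>dH \<kappa> X n\<^esub> \<longleftrightarrow>
      dD \<kappa> X n #>\<^bsub>dQ \<kappa> X n\<^esub> c \<in> dC_boundaries \<kappa> X n"
    unfolding homology_class_def
    using subgroup_dC_boundaries C.coset_join1 C.coset_join2 by metis
  moreover have "cube_boundary (n + 1) u \<in> carrier (dQ \<kappa> X n)" if "u \<in> carrier (dQ \<kappa> X (n + 1))" for u
    using that keys_cube_boundary[of u \<kappa> X "n + 1"] by (simp add: dQ_eq)
  ultimately show ?thesis
    unfolding dC_boundaries_eq using dD_coset_eq_iff[OF c] by blast
qed

section \<open>Restriction of chains to components\<close>

text \<open>For a component \<open>A\<close> of \<open>X\<close> this projects the chains of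
  \<open>X\<close> onto the summand of chains in \<open>A\<close>.\<close>

definition restrict_chain ::
    "adjacency \<Rightarrow> point set \<Rightarrow> int \<Rightarrow> ((point \<Rightarrow> point) \<Rightarrow>\<^sub>0 int) \<Rightarrow> ((point \<Rightarrow> point) \<Rightarrow>\<^sub>0 int)" where
  "restrict_chain \<kappa> A n = frag_extend (\<lambda>T. if T \<in> graded_cubes \<kappa> A n then frag_of T else 0)"

lemma restrict_chain_simps [simp]:
  "restrict_chain \<kappa> A n 0 = 0"
  "restrict_chain \<kappa> A n (a + b) = restrict_chain \<kappa> A n a + restrict_chain \<kappa> A n b"
  "restrict_chain \<kappa> A n (a - b) = restrict_chain \<kappa> A n a - restrict_chain \<kappa> A n b"
  "restrict_chain \<kappa> A n (frag_of T) = (if T \<in> graded_cubes \<kappa> A n then frag_of T else 0)"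
  by (simp_all add: restrict_chain_def frag_extend_add frag_extend_diff)

lemma restrict_chain_sum:
  "finite I \<Longrightarrow> restrict_chain \<kappa> A n (\<Sum>i\<in>I. c i) = (\<Sum>i\<in>I. restrict_chain \<kappa> A n (c i))"
  by (simp add: restrict_chain_def frag_extend_sum o_def)

lemma keys_restrict_chain:
  "Poly_Mapping.keys (restrict_chain \<kappa> A n c) \<subseteq> Poly_Mapping.keys c \<inter> graded_cubes \<kappa> A n"
  using keys_frag_extend[of "\<lambda>T. if T \<in> graded_cubes \<kappa> A n then frag_of T else 0" c]
  by (fastforce simp: restrict_chain_def keys_frag_of split: if_splits)

lemma restrict_chain_id:
  assumes "Poly_Mapping.keys c \<subseteq> graded_cubes \<kappa> A n"
  shows "restrict_chain \<kappa> A n c = c"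
  using assms by (induction c rule: frag_induction) simp_all

lemma graded_cubes_mono: "A \<subseteq> X \<Longrightarrow> graded_cubes \<kappa> A n \<subseteq> graded_cubes \<kappa> X n"
  by (auto simp: graded_cubes_def digital_cubes_def digitally_continuous_def)

lemma degenerate_cubes_mono: "A \<subseteq> X \<Longrightarrow> degenerate_cubes \<kappa> A n \<subseteq> degenerate_cubes \<kappa> X n"
  using graded_cubes_mono[of A X \<kappa> n] by (auto simp: degenerate_cubes_def)

lemma digital_components_subset: "A \<in> digital_components \<kappa> X \<Longrightarrow> A \<subseteq> X"
  by (simp add: digital_components_def)

text \<open>The image of a cube is connected, and every connected subset lies in a
  component.\<close>

lemma graded_cube_in_component:
  assumes "finite X" "T \<in> graded_cubes \<kappa> X n"
  obtains A where "A \<in> digital_components \<kappa> X" "T \<in> graded_cubes \<kappa> A n"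
proof -
  have T: "T \<in> digital_cubes \<kappa> X (nat n)" "0 \<le> n"
    using assms by (auto simp: graded_cubes_def split: if_splits)
  then have "T ` unit_cube (nat n) \<subseteq> X"
    by (auto simp: digital_cubes_def digitally_continuous_def)
  then obtain A where A: "A \<in> digital_components \<kappa> X" "T ` unit_cube (nat n) \<subseteq> A"
    using digitally_connected_subset_component[OF assms(1) _ digitally_connected_cube[OF T(1)]] by blast
  then have "T \<in> graded_cubes \<kappa> A n"
    using T by (auto simp: graded_cubes_def digital_cubes_def digitally_continuous_def)
  with A(1) show thesis
    by (rule that)
qed

lemma graded_cube_component_unique:
  assumes "A \<in> digital_components \<kappa> X" "B \<in> digital_components \<kappa> X"
    and "T \<in> graded_cubes \<kappa> A n" "T \<in> graded_cubes \<kappa> B n"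
  shows "A = B"
proof -
  \<comment> \<open>The origin is a vertex in every dimension; for dimension 0 it is
    \<open>[]\<close>. Its image is a common point of \<open>A\<close> and \<open>B\<close>.\<close>
  have "replicate (nat n) 0 \<in> unit_cube (nat n)"
    by (auto simp: unit_cube_def)
  then have "T (replicate (nat n) 0) \<in> A" "T (replicate (nat n) 0) \<in> B"
    using assms(3,4)
    by (auto simp: graded_cubes_def digital_cubes_def digitally_continuous_def split: if_splits)
  then show ?thesis
    using digital_components_eq[OF assms(1,2)] by blast
qed

text \<open>A cube lying in both \<open>A\<close> and \<open>B\<close> would force
  \<open>A = B\<close>, so no basis element of \<open>c\<close> survives.\<close>

lemma restrict_chain_other_component:
  assumes "A \<in> digital_components \<kappa> X" "B \<in> digital_components \<kappa> X" "A \<noteq> B"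
    and "Poly_Mapping.keys c \<subseteq> graded_cubes \<kappa> B n"
  shows "restrict_chain \<kappa> A n c = 0"
  using keys_restrict_chain[of \<kappa> A n c] graded_cube_component_unique[OF assms(1,2)] assms(3,4)
  by (metis (no_types, lifting) IntD1 IntD2 all_not_in_conv keys_eq_empty subset_eq)

text \<open>Each cube lies in exactly one component, so exactly one summand keeps it.\<close>

lemma sum_restrict_chain:
  assumes X: "finite X" and c: "Poly_Mapping.keys c \<subseteq> graded_cubes \<kappa> X n"
  shows "(\<Sum>A\<in>digital_components \<kappa> X. restrict_chain \<kappa> A n c) = c"
  using c
proof (induction c rule: frag_induction)
  case (one T)
  then obtain A where A: "A \<in> digital_components \<kappa> X" "T \<in> graded_cubes \<kappa> A n"
    using graded_cube_in_component[OF X] by blast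
  have "T \<in> graded_cubes \<kappa> B n \<longleftrightarrow> B = A" if "B \<in> digital_components \<kappa> X" for B
    using A that graded_cube_component_unique by blast
  then have "(\<Sum>B\<in>digital_components \<kappa> X. restrict_chain \<kappa> B n (frag_of T)) =
      (\<Sum>B\<in>digital_components \<kappa> X. if B = A then frag_of T else 0)"
    by (intro sum.cong) simp_all
  then show ?case
    using A(1) finite_digital_components[OF X] by simp
qed (simp_all add: sum_subtractf)

text \<open>A cube in the component \<open>B\<close> has all its faces in \<open>B\<close>. For
  \<open>A = B\<close> restriction fixes both the cube and its boundary; otherwise it annihilates
  both.\<close>

lemma restrict_chain_cube_boundary:
  assumes X: "finite X" and A: "A \<in> digital_components \<kappa> X"
    and c: "Poly_Mapping.keys c \<subseteq> graded_cubes \<kappa> X n"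
  shows "restrict_chain \<kappa> A (n - 1) (cube_boundary n c) = cube_boundary n (restrict_chain \<kappa> A n c)"
  using c
proof (induction c rule: frag_induction)
  case (one T)
  then obtain B where B: "B \<in> digital_components \<kappa> X" "T \<in> graded_cubes \<kappa> B n"
    using graded_cube_in_component[OF X] by blast
  then have faces: "Poly_Mapping.keys (cube_boundary n (frag_of T)) \<subseteq> graded_cubes \<kappa> B (n - 1)"
    by (intro keys_cube_boundary) (simp add: keys_frag_of)
  show ?case
  proof (cases "A = B")
    case True
    then show ?thesis
      using B(2) restrict_chain_id[OF faces] by simp
  next
    case False
    then have "T \<notin> graded_cubes \<kappa> A n"
      using graded_cube_component_unique[OF A B(1)] B(2) by blast
    then show ?thesis
      using restrict_chain_other_component[OF A B(1) False faces] by simp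
  qed
qed simp_all

lemma restrict_chain_in_chain_cycles:
  assumes X: "finite X" and A: "A \<in> digital_components \<kappa> X" and c: "c \<in> chain_cycles \<kappa> X n"
  shows "restrict_chain \<kappa> A n c \<in> chain_cycles \<kappa> A n"
proof -
  have c': "Poly_Mapping.keys c \<subseteq> graded_cubes \<kappa> X n"
      "Poly_Mapping.keys (cube_boundary n c) \<subseteq> degenerate_cubes \<kappa> X (n - 1)"
    using c by (simp_all add: chain_cycles_def dQ_eq dD_eq)
  \<comment> \<open>Degeneracy depends on the map alone, so a degenerate cube of \<open>X\<close>
    that lies in \<open>A\<close> is degenerate in \<open>A\<close>.\<close>
  have "Poly_Mapping.keys (cube_boundary n (restrict_chain \<kappa> A n c)) \<subseteq> degenerate_cubes \<kappa> A (n - 1)"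
    using restrict_chain_cube_boundary[OF X A c'(1)] c'(2)
      keys_restrict_chain[of \<kappa> A "n - 1" "cube_boundary n c"]
    by (auto simp: degenerate_cubes_def)
  then show ?thesis
    using keys_restrict_chain[of \<kappa> A n c] by (simp add: chain_cycles_def dQ_eq dD_eq)
qed

lemma chain_cycles_mono: "A \<subseteq> X \<Longrightarrow> chain_cycles \<kappa> A n \<subseteq> chain_cycles \<kappa> X n"
  using graded_cubes_mono[of A X \<kappa> n] degenerate_cubes_mono[of A X \<kappa> "n - 1"]
  by (auto simp: chain_cycles_def dQ_eq dD_eq)

lemma sum_in_chain_cycles:
  assumes "finite I" "\<And>i. i \<in> I \<Longrightarrow> c i \<in> chain_cycles \<kappa> X n"
  shows "sum c I \<in> chain_cycles \<kappa> X n"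
  using assms
  by (simp add: chain_cycles_def dQ_eq dD_eq cube_boundary_sum keys_sum_subset)

text \<open>Supplies the equality of the two kernels. In one direction a bounding chain of
  \<open>X\<close> is restricted to each component; in the other, bounding chains of the components
  are added.\<close>

lemma homology_class_eq_one_iff_components:
  assumes X: "finite X" and c: "c \<in> chain_cycles \<kappa> X n"
  shows "homology_class \<kappa> X n c = \<one>\<^bsub>dH \<kappa> X n\<^esub> \<longleftrightarrow>
    (\<forall>A \<in> digital_components \<kappa> X. homology_class \<kappa> A n (restrict_chain \<kappa> A n c) = \<one>\<^bsub>dH \<kappa> A n\<^esub>)"
proof -
  have cX: "Poly_Mapping.keys c \<subseteq> graded_cubes \<kappa> X n"
    using c by (simp add: chain_cycles_def dQ_eq)
  have X_iff: "homology_class \<kappa> X n c = \<one>\<^bsub>dH \<kappa> X n\<^esub> \<longleftrightarrow>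
      (\<exists>u. Poly_Mapping.keys u \<subseteq> graded_cubes \<kappa> X (n + 1) \<and>
        Poly_Mapping.keys (c - cube_boundary (n + 1) u) \<subseteq> degenerate_cubes \<kappa> X n)"
    using homology_class_eq_one_iff[of c \<kappa> X n] cX by (simp add: dQ_eq dD_eq Bex_def)
  have A_iff: "homology_class \<kappa> A n (restrict_chain \<kappa> A n c) = \<one>\<^bsub>dH \<kappa> A n\<^esub> \<longleftrightarrow>
      (\<exists>u. Poly_Mapping.keys u \<subseteq> graded_cubes \<kappa> A (n + 1) \<and>
        Poly_Mapping.keys (restrict_chain \<kappa> A n c - cube_boundary (n + 1) u) \<subseteq> degenerate_cubes \<kappa> A n)"
    for A
    using homology_class_eq_one_iff[of "restrict_chain \<kappa> A n c" \<kappa> A n] keys_restrict_chain[of \<kappa> A n c]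
    by (simp add: dQ_eq dD_eq Bex_def)
  show ?thesis
    unfolding X_iff A_iff
  proof (intro iffI ballI)
    fix A
    assume "\<exists>u. Poly_Mapping.keys u \<subseteq> graded_cubes \<kappa> X (n + 1) \<and>
        Poly_Mapping.keys (c - cube_boundary (n + 1) u) \<subseteq> degenerate_cubes \<kappa> X n"
      and A: "A \<in> digital_components \<kappa> X"
    then obtain u where u: "Poly_Mapping.keys u \<subseteq> graded_cubes \<kappa> X (n + 1)"
        "Poly_Mapping.keys (c - cube_boundary (n + 1) u) \<subseteq> degenerate_cubes \<kappa> X n"
      by blast
    have "restrict_chain \<kappa> A n (c - cube_boundary (n + 1) u) =
        restrict_chain \<kappa> A n c - cube_boundary (n + 1) (restrict_chain \<kappa> A (n + 1) u)"
      using restrict_chain_cube_boundary[OF X A u(1)] by simp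
    then have "Poly_Mapping.keys (restrict_chain \<kappa> A n c -
        cube_boundary (n + 1) (restrict_chain \<kappa> A (n + 1) u)) \<subseteq> degenerate_cubes \<kappa> A n"
      using keys_restrict_chain[of \<kappa> A n "c - cube_boundary (n + 1) u"] u(2)
      by (auto simp: degenerate_cubes_def)
    then show "\<exists>u. Poly_Mapping.keys u \<subseteq> graded_cubes \<kappa> A (n + 1) \<and>
        Poly_Mapping.keys (restrict_chain \<kappa> A n c - cube_boundary (n + 1) u) \<subseteq> degenerate_cubes \<kappa> A n"
      using keys_restrict_chain[of \<kappa> A "n + 1" u] by blast
  next
    assume "\<forall>A \<in> digital_components \<kappa> X. \<exists>u. Poly_Mapping.keys u \<subseteq> graded_cubes \<kappa> A (n + 1) \<and>
        Poly_Mapping.keys (restrict_chain \<kappa> A n c - cube_boundary (n + 1) u) \<subseteq> degenerate_cubes \<kappa> A n"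
    then obtain u where u: "\<And>A. A \<in> digital_components \<kappa> X \<Longrightarrow>
          Poly_Mapping.keys (u A) \<subseteq> graded_cubes \<kappa> A (n + 1)"
        "\<And>A. A \<in> digital_components \<kappa> X \<Longrightarrow>
          Poly_Mapping.keys (restrict_chain \<kappa> A n c - cube_boundary (n + 1) (u A)) \<subseteq> degenerate_cubes \<kappa> A n"
      by metis
    let ?u = "\<Sum>A\<in>digital_components \<kappa> X. u A"
    \<comment> \<open>Here \<open>c\<close> is replaced by the sum of its restrictions, so that each
      difference is degenerate in its component.\<close>
    have eq: "c - cube_boundary (n + 1) ?u =
        (\<Sum>A\<in>digital_components \<kappa> X. restrict_chain \<kappa> A n c - cube_boundary (n + 1) (u A))"
      using sum_restrict_chain[OF X cX] finite_digital_components[OF X]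
      by (simp add: sum_subtractf cube_boundary_sum)
    have "Poly_Mapping.keys (c - cube_boundary (n + 1) ?u) \<subseteq> degenerate_cubes \<kappa> X n"
      unfolding eq
      using u(2) degenerate_cubes_mono[OF digital_components_subset] by (intro keys_sum_subset) blast
    moreover have "Poly_Mapping.keys ?u \<subseteq> graded_cubes \<kappa> X (n + 1)"
      using u(1) graded_cubes_mono[OF digital_components_subset] by (intro keys_sum_subset) blast
    ultimately show "\<exists>u. Poly_Mapping.keys u \<subseteq> graded_cubes \<kappa> X (n + 1) \<and>
        Poly_Mapping.keys (c - cube_boundary (n + 1) u) \<subseteq> degenerate_cubes \<kappa> X n"
      by blast
  qed
qed

section \<open>The isomorphism\<close>

theorem proposition3p2:
  fixes d l :: nat and X :: "point set" and n :: int
  assumes "digital_image d l X"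
  shows "dH (c_adj l) X n \<cong>
    sum_group (digital_components (c_adj l) X) (\<lambda>A. dH (c_adj l) A n)"
proof -
  let ?\<kappa> = "c_adj l"
  let ?K = "digital_components ?\<kappa> X"
  let ?Z = "(dQ ?\<kappa> X n)\<lparr>carrier := chain_cycles ?\<kappa> X n\<rparr>"
  let ?S = "sum_group ?K (\<lambda>A. dH ?\<kappa> A n)"
  \<comment> \<open>The restricted lambda makes the family of classes extensional, as elements of
    \<open>sum_group\<close> are.\<close>
  define \<phi> where "\<phi> c = (\<lambda>A\<in>?K. homology_class ?\<kappa> A n (restrict_chain ?\<kappa> A n c))" for c
  have X: "finite X"
    using assms by (simp add: digital_image_def)
  have fin: "finite ?K"
    using finite_digital_components[OF X] .
  interpret Z: group_hom ?Z "dH ?\<kappa> X n" "homology_class ?\<kappa> X n"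
    by (rule group_hom_cycles_dH)
  have hom_A: "group_hom ((dQ ?\<kappa> A n)\<lparr>carrier := chain_cycles ?\<kappa> A n\<rparr>) (dH ?\<kappa> A n) (homology_class ?\<kappa> A n)" for A
    by (rule group_hom_cycles_dH)
  then have grp: "group (dH ?\<kappa> A n)" for A
    by (simp add: group_hom_def)
  \<comment> \<open>There are finitely many components, so the finite support condition of
    \<open>sum_group\<close> always holds and the direct sum is the full product.\<close>
  have carrier_S: "carrier ?S = (\<Pi>\<^sub>E A\<in>?K. homology_class ?\<kappa> A n ` chain_cycles ?\<kappa> A n)"
    using fin by (auto simp: carrier_sum_group grp carrier_dH)
  note restr = restrict_chain_in_chain_cycles[OF X]
  have \<phi>_closed: "\<phi> c \<in> carrier ?S" if "c \<in> chain_cycles ?\<kappa> X n" for c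
    using restr[OF _ that] by (auto simp: carrier_S \<phi>_def)
  have "\<phi> \<in> hom ?Z ?S"
  proof (rule homI)
    fix a b assume ab: "a \<in> carrier ?Z" "b \<in> carrier ?Z"
    have "homology_class ?\<kappa> A n (restrict_chain ?\<kappa> A n (a + b)) =
        homology_class ?\<kappa> A n (restrict_chain ?\<kappa> A n a) \<otimes>\<^bsub>dH ?\<kappa> A n\<^esub>
        homology_class ?\<kappa> A n (restrict_chain ?\<kappa> A n b)" if "A \<in> ?K" for A
      using group_hom.hom_mult[OF hom_A, of "restrict_chain ?\<kappa> A n a" A "restrict_chain ?\<kappa> A n b"]
        restr[OF that] ab by (simp add: dQ_eq)
    then show "\<phi> (a \<otimes>\<^bsub>?Z\<^esub> b) = \<phi> a \<otimes>\<^bsub>?S\<^esub> \<phi> b"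
      by (auto simp: \<phi>_def dQ_eq fun_eq_iff)
  qed (simp add: \<phi>_closed)
  then have hom_\<phi>: "group_hom ?Z ?S \<phi>"
    by (simp add: group_hom_def group_hom_axioms_def Z.G.is_group grp)
  have surj: "\<phi> ` carrier ?Z = carrier ?S"
  proof (intro equalityI subsetI)
    fix x assume x: "x \<in> carrier ?S"
    then have "\<forall>A \<in> ?K. \<exists>c \<in> chain_cycles ?\<kappa> A n. x A = homology_class ?\<kappa> A n c"
      by (auto simp: carrier_S)
    then obtain c where c: "\<And>A. A \<in> ?K \<Longrightarrow> c A \<in> chain_cycles ?\<kappa> A n"
        "\<And>A. A \<in> ?K \<Longrightarrow> x A = homology_class ?\<kappa> A n (c A)"
      by metis
    have keys: "Poly_Mapping.keys (c A) \<subseteq> graded_cubes ?\<kappa> A n" if "A \<in> ?K" for A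
      using c(1)[OF that] by (simp add: chain_cycles_def dQ_eq)
    have "restrict_chain ?\<kappa> A n (\<Sum>B\<in>?K. c B) = c A" if A: "A \<in> ?K" for A
    proof -
      \<comment> \<open>Restriction to \<open>A\<close> fixes \<open>c A\<close> and annihilates the
        cycles chosen in the other components, so the sum of all of them is a preimage of
        \<open>x\<close>.\<close>
      have "restrict_chain ?\<kappa> A n (\<Sum>B\<in>?K. c B) = (\<Sum>B\<in>?K. if B = A then c A else 0)"
        unfolding restrict_chain_sum[OF fin]
        using restrict_chain_id[OF keys[OF A]] restrict_chain_other_component[OF A _ _ keys]
        by (intro sum.cong) auto
      then show ?thesis
        using A fin by simp
    qed
    then have "x = \<phi> (\<Sum>B\<in>?K. c B)"
      using x c(2) by (auto simp: \<phi>_def carrier_S PiE_def extensional_def fun_eq_iff)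
    moreover have "(\<Sum>B\<in>?K. c B) \<in> chain_cycles ?\<kappa> X n"
      using c(1) chain_cycles_mono[OF digital_components_subset] fin
      by (intro sum_in_chain_cycles) blast+
    ultimately show "x \<in> \<phi> ` carrier ?Z"
      by simp
  qed (use \<phi>_closed in auto)
  \<comment> \<open>The unit of \<open>?S\<close> is the family of units, so the kernel of
    \<open>\<phi>\<close> is given by the componentwise condition in
    \<open>homology_class_eq_one_iff_components\<close>.\<close>
  have "\<phi> c = \<one>\<^bsub>?S\<^esub> \<longleftrightarrow> (\<forall>A \<in> ?K. homology_class ?\<kappa> A n (restrict_chain ?\<kappa> A n c) = \<one>\<^bsub>dH ?\<kappa> A n\<^esub>)" for c
    by (auto simp: \<phi>_def fun_eq_iff restrict_def)
  then have "kernel ?Z (dH ?\<kappa> X n) (homology_class ?\<kappa> X n) = kernel ?Z ?S \<phi>"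
    unfolding kernel_def using homology_class_eq_one_iff_components[OF X]
    by (intro Collect_cong conj_cong) simp_all
  then show ?thesis
    using iso_if_kernel_eq[OF Z.group_hom_axioms _ hom_\<phi> surj] by (simp add: carrier_dH)
qed

end
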